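(* Let $d\geq 1$, let $D:\mathbb{Z}^d\to[0,\infty)$ be a jump weight as in the context, with smoothness constant $\Delta>0$, and let $\kappa>0$. Let $c_n=\sum_{x\in\mathbb{Z}^d}C_n(x)$ be the total weight of $n$-step walks with interaction $U$ defined in the context. Assume that $\kappa$ is small enough so that $$(1+\kappa)^{2d}\leq 1+\frac{\Delta^2}{2d\,(1+\kappa)^{2d-1}}.$$ Then the sequence $(c_n^{1/n})_{n\geq1}$ converges to a number $\mu$ with $2^{-d}\leq\mu\leq c_1$.
   Context: $|x|$ denotes the $\ell_2$ norm of $x\in\mathbb{Z}^d$. Jump weight: $D:\mathbb{Z}^d\to[0,\infty)$ is invariant under permutations of coordinates and under inversions (sign changes) of coordinates, and satisfies $D(0)=0$, $\sum_y D(y)=1$, and $$\Delta:=\inf_{|x-y|=1,\;y\neq0}\frac{D(y)}{D(x)}>0,$$ where for $x=0$ the ratio is read as $+\infty$. Interaction: for $\kappa>0$, $U:\mathbb{Z}^d\to\mathbb{R}$ is given by $U(0)=1$, $U(x)=-\kappa$ if $|x|=1$, and $U(x)=0$ otherwise. Connectivity: for $n\geq0$ and $x\in\mathbb{Z}^d$, $$C_n(x)=\sum_{w}\;\prod_{t=1}^nD(w_t-w_{t-1})\prod_{0\leq s<t\leq n}\bigl(1-U(w_s-w_t)\bigr),$$ where the sum is over all $w=(w_0,\dots,w_n)\in(\mathbb{Z}^d)^{n+1}$ with $w_0=0$ and $w_n=x$. *)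

theory Defs
  imports "HOL-Analysis.Analysis"
begin

text \<open>The integer lattice is \<open>int ^ 'd\<close>, with \<open>CARD('d)\<close> as the dimension. There is no
  library norm on this type, so the Euclidean norm is taken in \<open>real ^ 'd\<close>.\<close>

definition znorm :: "int ^ 'd::finite \<Rightarrow> real" where
  "znorm x = norm (\<chi> i. real_of_int (x $ i) :: real ^ 'd)"

text \<open>If \<open>D x = 0\<close> for some \<open>x \<noteq> 0\<close>, then HOL division makes the ratios with denominator
  \<open>D x\<close> equal to 0. This does not affect the condition that the infimum is positive: if
  \<open>x, y \<noteq> 0\<close> are adjacent with \<open>D x = 0\<close> and \<open>D y > 0\<close>, the pair with the roles of
  \<open>x\<close> and \<open>y\<close> exchanged has ratio 0 under any convention, and a symmetric \<open>D\<close> without such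
  a pair is either positive everywhere off the origin or identically zero there, and the latter
  contradicts total mass 1.\<close>

definition smoothness :: "(int ^ 'd::finite \<Rightarrow> real) \<Rightarrow> ereal" where
  "smoothness D =
     (INF (x, y) \<in> {(x, y). znorm (x - y) = 1 \<and> y \<noteq> 0}.
        if x = 0 then \<infinity> else ereal (D y / D x))"

definition jump_weight :: "(int ^ 'd::finite \<Rightarrow> real) \<Rightarrow> bool" where
  "jump_weight D \<longleftrightarrow>
     (\<forall>x. 0 \<le> D x) \<and>
     (\<forall>\<pi> x. bij \<pi> \<longrightarrow> D (\<chi> i. x $ \<pi> i) = D x) \<and>
     (\<forall>j x. D (\<chi> i. if i = j then - (x $ i) else x $ i) = D x) \<and>
     D 0 = 0 \<and>
     (D has_sum 1) UNIV \<and>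
     0 < smoothness D"

definition U :: "real \<Rightarrow> int ^ 'd::finite \<Rightarrow> real" where
  "U \<kappa> x = (if x = 0 then 1 else if znorm x = 1 then - \<kappa> else 0)"

definition walks :: "nat \<Rightarrow> int ^ 'd::finite \<Rightarrow> (int ^ 'd) list set" where
  "walks n x = {w. length w = n + 1 \<and> w ! 0 = 0 \<and> w ! n = x}"

definition walk_weight ::
  "(int ^ 'd::finite \<Rightarrow> real) \<Rightarrow> real \<Rightarrow> nat \<Rightarrow> (int ^ 'd) list \<Rightarrow> real" where
  "walk_weight D \<kappa> n w =
     (\<Prod>t = 1..n. D (w ! t - w ! (t - 1))) *
     (\<Prod>(s, t) \<in> {(s, t). s < t \<and> t \<le> n}. 1 - U \<kappa> (w ! s - w ! t))"

text \<open>The two infinite sums below have nonnegative terms and converge for every jump weight and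
  every \<open>\<kappa> \<ge> 0\<close>: each interaction factor lies between 0 and \<open>1 + \<kappa>\<close>, and \<open>D\<close> has total
  mass 1. So \<open>infsum\<close> never takes its default value 0 here.\<close>

definition connectivity ::
  "(int ^ 'd::finite \<Rightarrow> real) \<Rightarrow> real \<Rightarrow> nat \<Rightarrow> int ^ 'd \<Rightarrow> real" where
  "connectivity D \<kappa> n x = (\<Sum>\<^sub>\<infinity>w\<in>walks n x. walk_weight D \<kappa> n w)"

definition total_weight :: "(int ^ 'd::finite \<Rightarrow> real) \<Rightarrow> real \<Rightarrow> nat \<Rightarrow> real" where
  "total_weight D \<kappa> n = (\<Sum>\<^sub>\<infinity>x\<in>UNIV. connectivity D \<kappa> n x)"

end

theory Submission
  imports Defs
begin

text \<open>By Fekete's lemma it suffices that \<open>c\<^sub>n\<close> is submultiplicative and at least \<open>2\<^bsup>-dn\<^esup>\<close>.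
  For the lower bound, keep only the steps in the closed positive orthant, which has mass at least
  \<open>2\<^bsup>-d\<^esup>\<close> by symmetry: the coordinate sum increases strictly along such walks, so they avoid
  themselves.

  For submultiplicativity, condition on the first \<open>m\<close> steps. The remaining \<open>n\<close> steps form a walk
  in the environment \<open>A\<close> of the sites already visited, and it is enough that removing the sites of
  \<open>A\<close> one at a time does not decrease the total weight of these walks. Removing \<open>a\<close> releases the walks
  through \<open>a\<close> and costs the walks that avoid \<open>a\<close> but touch its neighbours a factor of at most
  \<open>(1 + \<kappa>)\<^bsup>2d\<^esup>\<close>. Walks of the second kind turn into walks of the first kind when one visit to a
  neighbour of \<open>a\<close> is moved to \<open>a\<close> itself, and the smallness assumption on \<open>\<kappa>\<close> says that the release
  outweighs the cost.\<close>

subsection \<open>Submultiplicative sequences\<close>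

lemma submultiplicative_power:
  fixes c :: "nat \<Rightarrow> real"
  assumes pos: "\<And>n. 0 < c n" and sub: "\<And>m n. c (m + n) \<le> c m * c n"
  shows "c (k * m + r) \<le> c m ^ k * c r"
proof (induction k)
  case (Suc k)
  have "c (Suc k * m + r) \<le> c m * c (k * m + r)"
    using sub[of m "k * m + r"] by (simp add: add.assoc)
  also have "\<dots> \<le> c m * (c m ^ k * c r)"
    using Suc pos[of m] by (intro mult_left_mono) auto
  finally show ?case by (simp add: mult.assoc)
qed simp

text \<open>The limit is the infimum of the roots over \<open>n \<ge> 1\<close>. It is at least
  \<open>b\<close> because every root is, and at most \<open>c 1\<close> because this is the first
  root. For the upper estimate, compare \<open>c n\<close> with powers of one \<open>c m\<close>
  whose root is close to the infimum.\<close>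

lemma submultiplicative_root_convergent:
  fixes c :: "nat \<Rightarrow> real"
  assumes pos: "\<And>n. 0 < c n" and sub: "\<And>m n. c (m + n) \<le> c m * c n"
    and lower: "\<And>n. b ^ n \<le> c n" and b: "0 < b"
  shows "\<exists>\<mu>. (\<lambda>n. root n (c n)) \<longlonglongrightarrow> \<mu> \<and> b \<le> \<mu> \<and> \<mu> \<le> c 1"
proof -
  define r where "r n = root n (c n)" for n
  define \<mu> where "\<mu> = Inf (r ` {1..})"
  have rb: "b \<le> r n" if "n \<ge> 1" for n
    using that lower[of n] b real_root_le_mono[of n "b ^ n" "c n"]
    by (simp add: r_def real_root_power_cancel)
  have bdd: "bdd_below (r ` {1..})"
    using rb by (intro bdd_belowI2[of _ b]) auto
  have \<mu>_le: "\<mu> \<le> r n" if "n \<ge> 1" for n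
    unfolding \<mu>_def using that bdd by (intro cInf_lower) auto
  have b_le: "b \<le> \<mu>"
    unfolding \<mu>_def using rb by (intro cInf_greatest) auto
  have "r \<longlonglongrightarrow> \<mu>"
  proof (rule order_tendstoI)
    fix a assume "a < \<mu>"
    then show "\<forall>\<^sub>F n in sequentially. a < r n"
      using \<mu>_le by (intro eventually_sequentiallyI[of 1]) force
  next
    fix a assume "\<mu> < a"
    then obtain m where m: "m \<ge> 1" "r m < a"
      unfolding \<mu>_def by (subst (asm) cInf_less_iff) (use bdd in auto)
    define M where "M = Max (c ` {..<m})"
    have M: "c i \<le> M" if "i < m" for i
      unfolding M_def using that by (intro Max_ge) auto
    \<comment> \<open>\<open>exp l\<close> is the \<open>m\<close>-th root of \<open>c m\<close>, so
      it lies below \<open>a\<close>; the error term in \<open>bound\<close> is of order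
      \<open>1 / n\<close>.\<close>
    define l where "l = ln (c m) / m"
    have bound: "ln (c n) / n \<le> l + (m * \<bar>l\<bar> + \<bar>ln M\<bar>) / n" if "n \<ge> 1" for n
    proof -
      define k i where "k = n div m" and "i = n mod m"
      have n: "n = k * m + i" and i: "i < m"
        using m by (auto simp: k_def i_def)
      have "c n \<le> c m ^ k * c i"
        unfolding n by (rule submultiplicative_power[OF pos sub])
      then have "ln (c n) \<le> ln (c m ^ k * c i)"
        using pos[of n] by (intro ln_mono) auto
      also have "\<dots> = k * ln (c m) + ln (c i)"
        using pos[of m] pos[of i] by (simp add: ln_mult ln_realpow)
      also have "ln (c i) \<le> ln M"
        using M[OF i] pos[of i] by (intro ln_mono) auto
      also have "k * ln (c m) = n * l - i * l"
        using m by (simp add: l_def n field_simps)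
      \<comment> \<open>The remainder \<open>i\<close> of the division by \<open>m\<close>
        contributes an amount bounded independently of \<open>n\<close>.\<close>
      also have "- (i * l) \<le> m * \<bar>l\<bar>"
      proof -
        have "- (i * l) \<le> i * \<bar>l\<bar>"
          by (metis abs_ge_minus_self abs_mult abs_of_nat)
        also have "\<dots> \<le> m * \<bar>l\<bar>"
          using i by (intro mult_right_mono) auto
        finally show ?thesis .
      qed
      then have "n * l - i * l + ln M \<le> n * l + (m * \<bar>l\<bar> + \<bar>ln M\<bar>)" by linarith
      finally have "ln (c n) / n \<le> (n * l + (m * \<bar>l\<bar> + \<bar>ln M\<bar>)) / n"
        by (intro divide_right_mono) auto
      then show ?thesis
        using that by (simp add: add_divide_distrib)
    qed
    have r_exp: "r n = exp (ln (c n) / n)" if "n \<ge> 1" for n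
      using that pos[of n] by (simp add: r_def root_powr_inverse powr_def field_simps)
    have "(\<lambda>n. exp (l + (m * \<bar>l\<bar> + \<bar>ln M\<bar>) / n)) \<longlonglongrightarrow> exp (l + 0)"
      by (intro tendsto_intros tendsto_divide_0[OF tendsto_const] filterlim_real_sequentially
          filterlim_at_top_imp_at_infinity)
    moreover have "exp (l + 0) < a"
      using m r_exp[of m] by (simp add: l_def)
    ultimately have "\<forall>\<^sub>F n in sequentially. exp (l + (m * \<bar>l\<bar> + \<bar>ln M\<bar>) / n) < a"
      by (rule order_tendstoD)
    then show "\<forall>\<^sub>F n in sequentially. r n < a"
      using eventually_ge_at_top[of 1]
    proof eventually_elim
      case (elim n)
      have "r n \<le> exp (l + (m * \<bar>l\<bar> + \<bar>ln M\<bar>) / n)"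
        using bound[of n] elim r_exp[of n] by simp
      with elim show ?case by linarith
    qed
  qed
  moreover have "r 1 = c 1" by (simp add: r_def)
  ultimately show ?thesis
    using b_le \<mu>_le[of 1] unfolding r_def by auto
qed

text \<open>Nonnegativity lets summability on the product follow from summability of the iterated
  sums.\<close>

lemma has_sum_Times_mult:
  fixes f :: "'a \<Rightarrow> real" and g :: "'b \<Rightarrow> real"
  assumes f: "(f has_sum a) A" and g: "(g has_sum b) B"
    and "\<And>x. x \<in> A \<Longrightarrow> 0 \<le> f x" and "\<And>y. y \<in> B \<Longrightarrow> 0 \<le> g y"
  shows "((\<lambda>(x, y). f x * g y) has_sum a * b) (A \<times> B)"
proof (rule has_sum_SigmaI)
  show inner: "((\<lambda>y. case (x, y) of (x, y) \<Rightarrow> f x * g y) has_sum f x * b) B" for x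
    using has_sum_cmult_right[OF g, of "f x"] by simp
  show outer: "((\<lambda>x. f x * b) has_sum a * b) A"
    by (rule has_sum_cmult_left[OF f])
  show "(\<lambda>(x, y). f x * g y) summable_on A \<times> B"
    by (rule summable_on_SigmaI[OF inner has_sum_imp_summable[OF outer]]) (use assms in auto)
qed

subsection \<open>Lattice neighbours and the interaction\<close>

definition nbrs :: "int ^ 'd::finite \<Rightarrow> (int ^ 'd) set" where
  "nbrs x = {y. znorm (y - x) = 1}"

lemma znorm_minus_commute: "znorm (x - y) = znorm (y - x)"
proof -
  have "(\<chi> i. real_of_int ((x - y) $ i)) = - (\<chi> i. real_of_int ((y - x) $ i))"
    by (simp add: vec_eq_iff)
  then show ?thesis unfolding znorm_def by (metis norm_minus_cancel)
qed

lemma znorm_0 [simp]: "znorm 0 = 0"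
  by (simp add: znorm_def zero_vec_def[symmetric])

lemma znorm_eq_sqrt: "znorm x = sqrt (real_of_int (\<Sum>i\<in>UNIV. (x $ i)\<^sup>2))"
  by (simp add: znorm_def norm_vec_def L2_set_def)

lemma znorm_eq_1_iff: "znorm x = 1 \<longleftrightarrow> (\<Sum>i\<in>UNIV. (x $ i)\<^sup>2) = 1"
  unfolding znorm_eq_sqrt by (metis of_int_1 of_int_eq_iff real_sqrt_eq_1_iff)

lemma znorm_axis [simp]: "\<bar>s\<bar> = 1 \<Longrightarrow> znorm (axis i s) = 1"
proof -
  assume "\<bar>s\<bar> = 1"
  then have "s\<^sup>2 = 1" by (metis one_power2 power2_abs)
  moreover have "(axis i s $ j)\<^sup>2 = (if j = i then s\<^sup>2 else 0)" for j
    by (simp add: axis_def)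
  ultimately show ?thesis by (simp add: znorm_eq_1_iff)
qed

text \<open>Squares of integers that sum to 1 have exactly one nonzero term.\<close>

lemma znorm_1_imp_axis:
  assumes "znorm x = 1"
  obtains i s where "x = axis i s" "s = 1 \<or> s = -1"
proof -
  have s: "(\<Sum>i\<in>UNIV. (x $ i)\<^sup>2) = 1" using assms by (simp add: znorm_eq_1_iff)
  then obtain i where i: "x $ i \<noteq> 0"
    by (metis power_zero_numeral sum.neutral zero_neq_one)
  have split: "(x $ i)\<^sup>2 + (\<Sum>j\<in>UNIV - {i}. (x $ j)\<^sup>2) = 1"
    using s by (subst (asm) sum.remove[of _ i]) auto
  have rest: "0 \<le> (\<Sum>j\<in>UNIV - {i}. (x $ j)\<^sup>2)" by (intro sum_nonneg) auto
  have "(x $ i)\<^sup>2 > 0" using i by simp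
  with split rest have x1: "(x $ i)\<^sup>2 = 1" and "(\<Sum>j\<in>UNIV - {i}. (x $ j)\<^sup>2) = 0"
    by linarith+
  then have "\<forall>j\<in>UNIV - {i}. (x $ j)\<^sup>2 = 0"
    by (subst (asm) sum_nonneg_eq_0_iff) auto
  then have "x = axis i (x $ i)" by (auto simp: vec_eq_iff axis_def)
  moreover have "x $ i = 1 \<or> x $ i = -1" using x1 power2_eq_1_iff by blast
  ultimately show ?thesis using that by blast
qed

lemma nbrs_subset: "nbrs (x :: int ^ 'd::finite) \<subseteq> (\<lambda>(i, s). x + axis i s) ` (UNIV \<times> {1, -1})"
proof
  fix y assume "y \<in> nbrs x"
  then obtain i s where "y - x = axis i s" "s = 1 \<or> s = -1"
    unfolding nbrs_def using znorm_1_imp_axis by blast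
  then have "y = (\<lambda>(i, s). x + axis i s) (i, s)" "(i, s) \<in> UNIV \<times> {1, -1}"
    by (auto simp: algebra_simps)
  then show "y \<in> (\<lambda>(i, s). x + axis i s) ` (UNIV \<times> {1, -1})" by blast
qed

lemma finite_nbrs [simp]: "finite (nbrs x)"
  by (rule finite_subset[OF nbrs_subset]) simp

lemma card_nbrs: "card (nbrs (x :: int ^ 'd::finite)) \<le> 2 * CARD('d)"
proof -
  have "card (nbrs x) \<le> card ((UNIV :: 'd set) \<times> {1, -1 :: int})"
    by (rule surj_card_le[OF _ nbrs_subset]) simp
  then show ?thesis by (simp add: card_cartesian_product)
qed

lemma nbrs_commute: "y \<in> nbrs x \<longleftrightarrow> x \<in> nbrs y"
  by (simp add: nbrs_def znorm_minus_commute)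

lemma not_self_nbr: "x \<notin> nbrs x"
  by (simp add: nbrs_def)

abbreviation J :: "real \<Rightarrow> int ^ 'd::finite \<Rightarrow> real" where
  "J \<kappa> x \<equiv> 1 - U \<kappa> x"

lemma J_diff: "J \<kappa> (x - y) = (if x = y then 0 else if x \<in> nbrs y then 1 + \<kappa> else 1)"
  by (simp add: U_def nbrs_def)

lemma J_commute: "J \<kappa> (x - y) = J \<kappa> (y - x)"
  using nbrs_commute[of x y] by (auto simp: J_diff)

lemma J_nonneg: "0 \<le> \<kappa> \<Longrightarrow> 0 \<le> J \<kappa> x" by (simp add: U_def)

lemma J_le: "0 \<le> \<kappa> \<Longrightarrow> J \<kappa> x \<le> 1 + \<kappa>" by (simp add: U_def)

lemma J_ge_1: "0 \<le> \<kappa> \<Longrightarrow> x \<noteq> y \<Longrightarrow> 1 \<le> J \<kappa> (x - y)" by (simp add: J_diff)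

text \<open>By injectivity each site counts once; neighbours of \<open>x\<close> give
  \<open>1 + \<kappa>\<close>, and all other sites give at most 1. Having \<open>N\<close> in place
  of all neighbours makes room for excluding a known unoccupied one.\<close>

lemma prod_J_le:
  assumes "0 \<le> \<kappa>" "finite I" "inj_on f I" "f ` I \<inter> nbrs x \<subseteq> N" "finite N" "card N \<le> k"
  shows "(\<Prod>i\<in>I. J \<kappa> (f i - x)) \<le> (1 + \<kappa>) ^ k"
proof -
  have "(\<Prod>i\<in>I. J \<kappa> (f i - x)) = (\<Prod>y\<in>f ` I. J \<kappa> (y - x))"
    using assms by (simp add: prod.reindex)
  also have "\<dots> \<le> (\<Prod>y\<in>f ` I. if y \<in> nbrs x then 1 + \<kappa> else 1)"
    using assms by (intro prod_mono) (auto simp: J_diff not_self_nbr)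
  also have "\<dots> = (1 + \<kappa>) ^ card (f ` I \<inter> nbrs x)"
    using assms by (simp add: prod.If_cases)
  also have "\<dots> \<le> (1 + \<kappa>) ^ k"
    using assms card_mono[OF assms(5,4)] by (intro power_increasing) auto
  finally show ?thesis .
qed

subsection \<open>Walks and their concatenation\<close>

definition rooted :: "nat \<Rightarrow> (int ^ 'd::finite) list set" where
  "rooted n = {w. length w = n + 1 \<and> w ! 0 = 0}"

text \<open>The step function is a parameter because the lower bound uses \<open>D\<close> cut off
  outside an orthant.\<close>

definition steps :: "(int ^ 'd::finite \<Rightarrow> real) \<Rightarrow> nat \<Rightarrow> (int ^ 'd) list \<Rightarrow> real" where
  "steps g n w = (\<Prod>t = 1..n. g (w ! t - w ! (t - 1)))"

definition pairs :: "nat \<Rightarrow> (nat \<times> nat) set" where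
  "pairs n = {(s, t). s < t \<and> t \<le> n}"

definition self_int :: "real \<Rightarrow> nat \<Rightarrow> (int ^ 'd::finite) list \<Rightarrow> real" where
  "self_int \<kappa> n w = (\<Prod>(s, t)\<in>pairs n. J \<kappa> (w ! s - w ! t))"

text \<open>The start \<open>w ! 0\<close> is left out: it is the end point of the preceding walk, whose own weight
  already contains that contact.\<close>
definition env_int :: "real \<Rightarrow> (int ^ 'd::finite) set \<Rightarrow> nat \<Rightarrow> (int ^ 'd) list \<Rightarrow> real" where
  "env_int \<kappa> A n w = (\<Prod>t = 1..n. \<Prod>a\<in>A. J \<kappa> (w ! t - a))"

text \<open>\<open>tl\<close> drops the start of \<open>v\<close>, which after the translation
  coincides with the end of \<open>u\<close>.\<close>

definition glue :: "(int ^ 'd::finite) list \<Rightarrow> (int ^ 'd) list \<Rightarrow> (int ^ 'd) list" where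
  "glue u v = u @ map ((+) (last u)) (tl v)"

lemma walk_weight_eq: "walk_weight D \<kappa> n w = steps D n w * self_int \<kappa> n w"
  by (simp add: walk_weight_def steps_def self_int_def pairs_def)

lemma finite_pairs [simp]: "finite (pairs n)"
  by (rule finite_subset[of _ "{..n} \<times> {..n}"]) (auto simp: pairs_def)

lemma length_glue: "u \<in> rooted m \<Longrightarrow> v \<in> rooted n \<Longrightarrow> length (glue u v) = m + n + 1"
  by (simp add: glue_def rooted_def)

lemma nth_glue_left: "u \<in> rooted m \<Longrightarrow> s \<le> m \<Longrightarrow> glue u v ! s = u ! s"
  by (simp add: glue_def rooted_def nth_append)

lemma nth_glue_right:
  assumes "u \<in> rooted m" "v \<in> rooted n" "t \<le> n"
  shows "glue u v ! (m + t) = u ! m + v ! t"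
proof (cases t)
  case 0
  then show ?thesis using assms by (simp add: nth_glue_left rooted_def)
next
  case (Suc t')
  have "last u = u ! m"
    using assms(1) by (subst last_conv_nth) (auto simp: rooted_def)
  then show ?thesis using assms Suc
    by (simp add: glue_def rooted_def nth_append nth_tl)
qed

lemma glue_rooted: "u \<in> rooted m \<Longrightarrow> v \<in> rooted n \<Longrightarrow> glue u v \<in> rooted (m + n)"
  using length_glue[of u m v n] nth_glue_left[of u m 0 v] by (simp add: rooted_def)

text \<open>The inverse cuts at time \<open>m\<close>. Both pieces keep the site at the cut, and the
  second is translated back to the origin.\<close>

lemma bij_betw_glue: "bij_betw (\<lambda>(u, v). glue u v) (rooted m \<times> rooted n) (rooted (m + n))"
proof (rule bij_betwI[where g = "\<lambda>w. (take (m + 1) w, map (\<lambda>x. x - w ! m) (drop m w))"])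
  show "(\<lambda>(u, v). glue u v) \<in> rooted m \<times> rooted n \<rightarrow> rooted (m + n)"
    by (auto intro: glue_rooted)
  show "(\<lambda>w. (take (m + 1) w, map (\<lambda>x. x - w ! m) (drop m w))) \<in> rooted (m + n) \<rightarrow> rooted m \<times> rooted n"
    by (auto simp: rooted_def)
next
  fix p :: "(int ^ 'a) list \<times> (int ^ 'a) list" assume "p \<in> rooted m \<times> rooted n"
  then obtain u v where p: "p = (u, v)" and uv: "u \<in> rooted m" "v \<in> rooted n" by auto
  have "take (m + 1) (glue u v) = u"
    using uv by (simp add: glue_def rooted_def)
  moreover have "map (\<lambda>x. x - glue u v ! m) (drop m (glue u v)) = v"
  proof (rule nth_equalityI)
    show "length (map (\<lambda>x. x - glue u v ! m) (drop m (glue u v))) = length v"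
      using uv length_glue[OF uv] by (simp add: rooted_def)
  next
    fix i assume "i < length (map (\<lambda>x. x - glue u v ! m) (drop m (glue u v)))"
    then have "i \<le> n" using length_glue[OF uv] by simp
    then show "map (\<lambda>x. x - glue u v ! m) (drop m (glue u v)) ! i = v ! i"
      using uv length_glue[OF uv] nth_glue_right[OF uv, of i] nth_glue_left[OF uv(1), of m v]
      by simp
  qed
  ultimately show "(\<lambda>w. (take (m + 1) w, map (\<lambda>x. x - w ! m) (drop m w)))
      ((\<lambda>(u, v). glue u v) p) = p"
    by (simp add: p)
next
  fix w :: "(int ^ 'a) list" assume w: "w \<in> rooted (m + n)"
  have "last (take (m + 1) w) = w ! m"
    using w by (subst last_conv_nth) (auto simp: rooted_def min_def)
  then have "glue (take (m + 1) w) (map (\<lambda>x. x - w ! m) (drop m w)) = take (m + 1) w @ tl (drop m w)"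
    by (simp add: glue_def map_tl o_def)
  also have "\<dots> = w" by (metis append_take_drop_id tl_drop drop_Suc Suc_eq_plus1)
  finally show "(\<lambda>(u, v). glue u v) (take (m + 1) w, map (\<lambda>x. x - w ! m) (drop m w)) = w"
    by simp
qed

lemma steps_glue:
  assumes "u \<in> rooted m" "v \<in> rooted n"
  shows "steps g (m + n) (glue u v) = steps g m u * steps g n v"
proof -
  have "steps g (m + n) (glue u v) =
      (\<Prod>t = 1..m. g (glue u v ! t - glue u v ! (t - 1))) *
      (\<Prod>t = m + 1..m + n. g (glue u v ! t - glue u v ! (t - 1)))"
    unfolding steps_def by (rule prod.ub_add_nat) simp
  also have "(\<Prod>t = m + 1..m + n. g (glue u v ! t - glue u v ! (t - 1))) =
      (\<Prod>t = 1..n. g (glue u v ! (m + t) - glue u v ! (m + (t - 1))))"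
    by (rule prod.reindex_bij_witness[of _ "\<lambda>t. m + t" "\<lambda>t. t - m"]) auto
  also have "\<dots> = steps g n v"
    unfolding steps_def
    using assms by (intro prod.cong) (auto simp: nth_glue_right simp del: add_diff_assoc diff_add_assoc)
  also have "(\<Prod>t = 1..m. g (glue u v ! t - glue u v ! (t - 1))) = steps g m u"
    unfolding steps_def using assms by (intro prod.cong) (auto simp: nth_glue_left)
  finally show ?thesis .
qed

text \<open>A pair of times lies before the cut \<open>m\<close>, after it, or strictly straddles
  it. Pairs containing \<open>m\<close> itself belong to the first two blocks, hence the ranges
  \<open>{1..n}\<close> and \<open>{..<m}\<close>.\<close>

lemma pairs_add:
  "pairs (m + n) = pairs m \<union> ((\<lambda>(s, t). (m + s, m + t)) ` pairs n \<union> (\<lambda>(t, s). (s, m + t)) ` ({1..n} \<times> {..<m}))"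
proof -
  have "(s, t) \<in> pairs m \<union> ((\<lambda>(s, t). (m + s, m + t)) ` pairs n \<union> (\<lambda>(t, s). (s, m + t)) ` ({1..n} \<times> {..<m}))"
    if "s < t" "t \<le> m + n" for s t
  proof -
    consider "t \<le> m" | "t > m" "s < m" | "s \<ge> m" by linarith
    then show ?thesis
    proof cases
      case 2
      then have "(s, t) = (\<lambda>(t, s). (s, m + t)) (t - m, s)" by simp
      moreover have "(t - m, s) \<in> {1..n} \<times> {..<m}" using that 2 by auto
      ultimately show ?thesis by blast
    next
      case 3
      then have "(s, t) = (\<lambda>(s, t). (m + s, m + t)) (s - m, t - m)" using that by simp
      moreover have "(s - m, t - m) \<in> pairs n" using that 3 by (auto simp: pairs_def)
      ultimately show ?thesis by blast
    qed (use that in \<open>auto simp: pairs_def\<close>)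
  qed
  then show ?thesis by (auto simp: pairs_def)
qed

lemma self_int_nonzero_inj:
  assumes "self_int \<kappa> n w \<noteq> 0"
  shows "inj_on ((!) w) {..n}"
proof (rule linorder_inj_onI)
  fix s t assume st: "s < t" "s \<in> {..n}" "t \<in> {..n}"
  then have "(s, t) \<in> pairs n" by (auto simp: pairs_def)
  then have "J \<kappa> (w ! s - w ! t) \<noteq> 0"
    using assms unfolding self_int_def by force
  then show "w ! s \<noteq> w ! t" by (auto simp: J_diff)
qed auto

text \<open>Straddling pairs become contacts of \<open>v\<close> with the past of \<open>u\<close>,
  seen from the end of \<open>u\<close>. That end is not in the environment: it is
  \<open>v ! 0\<close>, whose contacts \<open>self_int\<close> of \<open>v\<close> already
  counts.\<close>

lemma self_int_glue:
  assumes u: "u \<in> rooted m" and v: "v \<in> rooted n"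
  shows "self_int \<kappa> (m + n) (glue u v) =
    self_int \<kappa> m u * (self_int \<kappa> n v * env_int \<kappa> ((\<lambda>s. u ! s - u ! m) ` {..<m}) n v)"
proof (cases "self_int \<kappa> m u = 0")
  \<comment> \<open>The environment is a set, so it would count a site that \<open>u\<close> visits
    twice only once. If \<open>u\<close> intersects itself, both sides vanish; otherwise times and
    past sites correspond one to one.\<close>
  case True
  have sub: "self_int \<kappa> m u = (\<Prod>(s, t)\<in>pairs m. J \<kappa> (glue u v ! s - glue u v ! t))"
    unfolding self_int_def using u by (intro prod.cong) (auto simp: nth_glue_left pairs_def)
  have "pairs m \<subseteq> pairs (m + n)" by (auto simp: pairs_def)
  then have "self_int \<kappa> (m + n) (glue u v) = 0"
    using True unfolding sub unfolding self_int_def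
    by (metis (no_types, lifting) finite_pairs prod_zero_iff subsetD)
  with True show ?thesis by simp
next
  case False
  define f where "f = (\<lambda>(s, t). J \<kappa> (glue u v ! s - glue u v ! t))"
  have inj: "inj_on (\<lambda>s. u ! s - u ! m) {..<m}"
    using self_int_nonzero_inj[OF False] by (auto simp: inj_on_def)
  have "self_int \<kappa> (m + n) (glue u v) = prod f (pairs m) *
     (prod f ((\<lambda>(s, t). (m + s, m + t)) ` pairs n) * prod f ((\<lambda>(t, s). (s, m + t)) ` ({1..n} \<times> {..<m})))"
    unfolding self_int_def f_def[symmetric] pairs_add
    by (subst prod.union_disjoint; (subst prod.union_disjoint)?;
        (intro finite_UnI finite_imageI finite_pairs)?) (auto simp: pairs_def)
  also have "prod f (pairs m) = self_int \<kappa> m u"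
    unfolding self_int_def f_def using u by (intro prod.cong) (auto simp: nth_glue_left pairs_def)
  also have "prod f ((\<lambda>(s, t). (m + s, m + t)) ` pairs n) = self_int \<kappa> n v"
    unfolding self_int_def f_def using u v
    by (subst prod.reindex) (auto intro!: prod.cong inj_onI simp: nth_glue_right pairs_def)
  also have "prod f ((\<lambda>(t, s). (s, m + t)) ` ({1..n} \<times> {..<m})) =
      (\<Prod>(t, s)\<in>{1..n} \<times> {..<m}. J \<kappa> (v ! t - (u ! s - u ! m)))"
  proof (subst prod.reindex)
    show "prod (f \<circ> (\<lambda>(t, s). (s, m + t))) ({1..n} \<times> {..<m}) =
      (\<Prod>(t, s)\<in>{1..n} \<times> {..<m}. J \<kappa> (v ! t - (u ! s - u ! m)))"
    proof (rule prod.cong[OF refl])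
      fix p assume "p \<in> {1..n} \<times> {..<m}"
      then obtain t s where "p = (t, s)" "t \<in> {1..n}" "s \<in> {..<m}" by auto
      then show "(f \<circ> (\<lambda>(t, s). (s, m + t))) p = (case p of (t, s) \<Rightarrow> J \<kappa> (v ! t - (u ! s - u ! m)))"
        using nth_glue_right[OF u v, of t] nth_glue_left[OF u, of s v]
          J_commute[of \<kappa> "u ! s" "u ! m + v ! t"]
        by (simp add: f_def algebra_simps)
    qed
  qed (auto intro: inj_onI)
  also have "\<dots> = env_int \<kappa> ((\<lambda>s. u ! s - u ! m) ` {..<m}) n v"
    unfolding env_int_def using inj by (simp add: prod.cartesian_product[symmetric] prod.reindex)
  finally show ?thesis .
qed

lemma bij_betw_rooted_1: "bij_betw (\<lambda>x. [0, x]) UNIV (rooted 1)"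
  by (rule bij_betwI[where g = "\<lambda>w. w ! 1"])
    (auto simp: rooted_def length_Suc_conv numeral_2_eq_2)

text \<open>Steps are independent, so splitting off the last one with \<open>glue\<close> multiplies
  the mass by \<open>q\<close>.\<close>

lemma has_sum_steps:
  fixes g :: "int ^ 'd::finite \<Rightarrow> real"
  assumes g: "(g has_sum q) UNIV" and nonneg: "\<And>x. 0 \<le> g x"
  shows "(steps g n has_sum q ^ n) (rooted n)"
proof (induction n)
  case 0
  have "rooted 0 = {[0 :: int ^ 'd]}" by (auto simp: rooted_def length_Suc_conv)
  moreover have "steps g 0 = (\<lambda>_. 1)" by (simp add: steps_def fun_eq_iff)
  ultimately show ?case using has_sum_finite[of "{[0 :: int ^ 'd]}" "\<lambda>_. 1 :: real"] by simp
next
  case (Suc n)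
  have one: "(steps g 1 has_sum q) (rooted 1)"
    by (subst has_sum_reindex_bij_betw[OF bij_betw_rooted_1, symmetric]) (use g in \<open>simp add: steps_def\<close>)
  have pos: "0 \<le> steps g k w" for k w
    unfolding steps_def by (intro prod_nonneg) (simp add: nonneg)
  have "((\<lambda>(u, v). steps g n u * steps g 1 v) has_sum q ^ n * q) (rooted n \<times> rooted 1)"
    by (rule has_sum_Times_mult[OF Suc one pos pos])
  then have "((\<lambda>p. steps g (n + 1) ((\<lambda>(u, v). glue u v) p)) has_sum q ^ n * q) (rooted n \<times> rooted 1)"
    by (rule has_sum_cong[THEN iffD1, rotated]) (auto simp: steps_glue[of _ n _ 1, simplified])
  then show ?case
    by (subst (asm) has_sum_reindex_bij_betw[OF bij_betw_glue]) (simp add: mult.commute)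
qed

subsection \<open>Moving one site of a walk\<close>

lemma U_nonpos: "0 \<le> \<kappa> \<Longrightarrow> x \<noteq> y \<Longrightarrow> U \<kappa> (x - y) \<le> 0"
  by (simp add: U_def)

lemma env_int_insert:
  "finite A \<Longrightarrow> a \<notin> A \<Longrightarrow>
    env_int \<kappa> (insert a A) n w = env_int \<kappa> A n w * (\<Prod>t = 1..n. J \<kappa> (w ! t - a))"
  by (simp add: env_int_def prod.distrib mult.commute)

lemma self_int_nonneg: "0 \<le> \<kappa> \<Longrightarrow> 0 \<le> self_int \<kappa> n w"
  unfolding self_int_def by (intro prod_nonneg) (auto intro: J_nonneg)

lemma env_int_nonneg: "0 \<le> \<kappa> \<Longrightarrow> 0 \<le> env_int \<kappa> A n w"
  unfolding env_int_def by (intro prod_nonneg ballI J_nonneg) auto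

lemma env_int_nonzero_notin:
  assumes "env_int \<kappa> A n w \<noteq> 0" "finite A" "1 \<le> t" "t \<le> n"
  shows "w ! t \<notin> A"
proof
  assume "w ! t \<in> A"
  then have "(\<Prod>a\<in>A. J \<kappa> (w ! t - a)) = 0"
    using assms by (intro prod_zero) (auto simp: J_diff)
  then have "env_int \<kappa> A n w = 0"
    unfolding env_int_def using assms(2-4) by (intro prod_zero bexI[of _ t]) simp_all
  with assms(1) show False ..
qed

text \<open>Only pairs containing \<open>t\<close> change. Their old factors form the last product,
  and their new factors are at least 1 because \<open>a\<close> is not visited by
  \<open>w\<close>.\<close>

lemma self_int_update_le:
  assumes k: "0 \<le> \<kappa>" and w: "w \<in> rooted n" and t: "t \<le> n" and a: "a \<notin> set w"
  shows "self_int \<kappa> n w \<le> self_int \<kappa> n (w[t := a]) * (\<Prod>s\<in>{..n} - {t}. J \<kappa> (w ! s - w ! t))"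
proof -
  define E where "E = (\<lambda>(s, r). if s = t \<or> r = t then J \<kappa> (w ! s - w ! r) else 1)"
  define F where "F = (\<lambda>(s, r). J \<kappa> (w[t := a] ! s - w[t := a] ! r))"
  have len: "length w = n + 1" using w by (simp add: rooted_def)
  have a': "w ! s \<noteq> a" if "s \<le> n" for s using a len that by (metis Suc_eq_plus1 le_imp_less_Suc nth_mem)
  have "self_int \<kappa> n w \<le> (\<Prod>p\<in>pairs n. F p * E p)"
    unfolding self_int_def
  proof (rule prod_mono)
    fix p assume p: "p \<in> pairs n"
    then obtain s r where sr: "p = (s, r)" "s < r" "r \<le> n" by (auto simp: pairs_def)
    have "J \<kappa> (w ! s - w ! r) \<le> F p * E p"
    proof (cases "s = t \<or> r = t")
      case True
      then have "1 \<le> F p"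
        using sr len t a'[of s] a'[of r] by (auto simp: F_def intro!: U_nonpos k)
      then show ?thesis
          using True mult_right_mono[OF _ J_nonneg[OF k], of 1 "F p" "w ! s - w ! r"]
          by (simp only: E_def sr) simp
    qed (auto simp: E_def F_def sr)
    then show "0 \<le> (case p of (s, t) \<Rightarrow> J \<kappa> (w ! s - w ! t)) \<and>
        (case p of (s, t) \<Rightarrow> J \<kappa> (w ! s - w ! t)) \<le> F p * E p"
      using J_nonneg[OF k] by (simp add: sr)
  qed
  also have "\<dots> = self_int \<kappa> n (w[t := a]) * prod E (pairs n)"
    by (simp add: prod.distrib self_int_def F_def)
  also have "prod E (pairs n) = prod E {p \<in> pairs n. fst p = t \<or> snd p = t}"
    by (rule prod.mono_neutral_right) (auto simp: E_def split: if_splits)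
  \<comment> \<open>A pair containing \<open>t\<close> is indexed by its other member;
    \<open>min\<close> and \<open>max\<close> restore the order.\<close>
  also have "\<dots> = (\<Prod>s\<in>{..n} - {t}. J \<kappa> (w ! s - w ! t))"
    by (rule prod.reindex_bij_witness[of _ "\<lambda>s. (min s t, max s t)" "\<lambda>(s, r). if s = t then r else s"])
      (use t in \<open>auto simp: pairs_def E_def min_def max_def J_commute\<close>)
  finally show ?thesis .
qed

text \<open>Only the factor at time \<open>t\<close> changes, and its new value is at least 1
  because \<open>a\<close> lies outside \<open>A\<close>.\<close>

lemma env_int_update_le:
  assumes k: "0 \<le> \<kappa>" and w: "w \<in> rooted n" and t: "1 \<le> t" "t \<le> n" and a: "a \<notin> A"
  shows "env_int \<kappa> A n w \<le> env_int \<kappa> A n (w[t := a]) * (\<Prod>b\<in>A. J \<kappa> (b - w ! t))"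
proof -
  define G where "G v s = (\<Prod>b\<in>A. J \<kappa> (v ! s - b))" for v s
  have len: "length w = n + 1" using w by (simp add: rooted_def)
  have G_nonneg: "0 \<le> G v s" for v s
    unfolding G_def by (intro prod_nonneg ballI J_nonneg k)
  have "env_int \<kappa> A n w = G w t * (\<Prod>s\<in>{1..n} - {t}. G w s)"
    unfolding env_int_def G_def using t by (subst prod.remove[of _ t]) auto
  also have "(\<Prod>s\<in>{1..n} - {t}. G w s) = (\<Prod>s\<in>{1..n} - {t}. G (w[t := a]) s)"
    by (rule prod.cong) (auto simp: G_def)
  also have "G w t * \<dots> \<le> G w t * (G (w[t := a]) t * \<dots>)"
  proof -
    have "1 \<le> G (w[t := a]) t"
      unfolding G_def using len t a by (intro prod_ge_1) (auto intro!: U_nonpos k)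
    then show ?thesis
      using mult_right_mono[of 1 "G (w[t := a]) t" "\<Prod>s\<in>{1..n} - {t}. G (w[t := a]) s"]
      by (intro mult_left_mono G_nonneg) (simp add: prod_nonneg G_nonneg)
  qed
  also have "G (w[t := a]) t * (\<Prod>s\<in>{1..n} - {t}. G (w[t := a]) s) = env_int \<kappa> A n (w[t := a])"
    unfolding env_int_def G_def using t by (subst (2) prod.remove[of _ t]) auto
  also have "G w t = (\<Prod>b\<in>A. J \<kappa> (b - w ! t))"
    unfolding G_def by (rule prod.cong[OF refl J_commute])
  finally show ?thesis
    by (simp only: mult.commute)
qed

section \<open>Weights of walks in an environment of visited sites\<close>

locale attractive_walk =
  fixes D :: "int ^ 'd::finite \<Rightarrow> real" and \<kappa> \<Delta> :: real
  assumes D_nonneg: "0 \<le> D x"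
    and D_flip: "D (\<chi> i. if i = j then - (x $ i) else x $ i) = D x"
    and D_0: "D 0 = 0"
    and D_sum: "(D has_sum 1) UNIV"
    and D_smooth: "x \<in> nbrs y \<Longrightarrow> y \<noteq> 0 \<Longrightarrow> \<Delta> * D x \<le> D y"
    and Delta_pos: "0 < \<Delta>" and Delta_le_1: "\<Delta> \<le> 1"
    and kappa_nonneg: "0 \<le> \<kappa>"
    and kappa_small: "(1 + \<kappa>) ^ (2 * CARD('d)) \<le>
           1 + \<Delta>\<^sup>2 / (2 * real CARD('d) * (1 + \<kappa>) ^ (2 * CARD('d) - 1))"
begin

definition W :: "(int ^ 'd) set \<Rightarrow> nat \<Rightarrow> (int ^ 'd) list \<Rightarrow> real" where
  "W A n w = steps D n w * self_int \<kappa> n w * env_int \<kappa> A n w"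

lemma steps_nonneg: "0 \<le> steps D n w"
  unfolding steps_def by (intro prod_nonneg) (simp add: D_nonneg)

lemma W_nonneg: "0 \<le> W A n w"
  unfolding W_def
  by (intro mult_nonneg_nonneg steps_nonneg self_int_nonneg env_int_nonneg kappa_nonneg)

lemma W_empty: "W {} n w = walk_weight D \<kappa> n w"
  by (simp add: W_def walk_weight_eq env_int_def)

text \<open>Moving the site at time \<open>t\<close> by a unit vector changes only the steps
  \<open>t\<close> and \<open>t + 1\<close>, each at a cost of at most \<open>\<Delta>\<close>.
  Since \<open>w\<close> does not visit \<open>a\<close>, the new steps are nonzero, as
  \<open>D_smooth\<close> requires.\<close>

lemma steps_update_ge:
  assumes w: "w \<in> rooted n" and t: "1 \<le> t" "t \<le> n" and a: "a \<notin> set w" "a \<in> nbrs (w ! t)"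
  shows "\<Delta>\<^sup>2 * steps D n w \<le> steps D n (w[t := a])"
proof -
  \<comment> \<open>For \<open>t = n\<close> there is no step \<open>t + 1\<close>; then
    \<open>\<Delta> \<le> 1\<close> makes \<open>\<Delta>\<^sup>2\<close> a valid lower bound for
    the single factor.\<close>
  define e where "e r = (if r \<in> {t, t + 1} then \<Delta> else 1)" for r
  have len: "length w = n + 1" using w by (simp add: rooted_def)
  have a': "w ! s \<noteq> a" if "s \<le> n" for s using a len that by (metis Suc_eq_plus1 le_imp_less_Suc nth_mem)
  have "\<Delta>\<^sup>2 \<le> \<Delta> ^ card ({1..n} \<inter> {t, t + 1})"
    using Delta_pos Delta_le_1 card_mono[of "{t, t + 1}" "{1..n} \<inter> {t, t + 1}"]
    by (intro power_decreasing) auto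
  also have "\<dots> = (\<Prod>r = 1..n. e r)"
    unfolding e_def by (subst prod.If_cases) (auto intro!: arg_cong[where f = "\<lambda>S. \<Delta> ^ card S"])
  finally have "\<Delta>\<^sup>2 * steps D n w \<le> (\<Prod>r = 1..n. e r) * steps D n w"
    by (intro mult_right_mono steps_nonneg)
  also have "\<dots> = (\<Prod>r = 1..n. e r * D (w ! r - w ! (r - 1)))"
    by (simp add: steps_def prod.distrib)
  also have "\<dots> \<le> steps D n (w[t := a])"
    unfolding steps_def
  proof (rule prod_mono)
    fix r assume r: "r \<in> {1..n}"
    have "e r * D (w ! r - w ! (r - 1)) \<le> D (w[t := a] ! r - w[t := a] ! (r - 1))"
    proof -
      consider "r = t" | "r = t + 1" | "r \<noteq> t" "r \<noteq> t + 1" by blast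
      then show ?thesis
      proof cases
        case 1
        have "w ! r - w ! (r - 1) \<in> nbrs (a - w ! (r - 1))"
          using a(2) 1 by (simp add: nbrs_def znorm_minus_commute)
        moreover have "a - w ! (r - 1) \<noteq> 0" using a'[of "r - 1"] r by (metis One_nat_def atLeastAtMost_iff diff_le_self eq_iff_diff_eq_0 order_trans)
        ultimately have "\<Delta> * D (w ! r - w ! (r - 1)) \<le> D (a - w ! (r - 1))"
          by (rule D_smooth)
        then show ?thesis
          using 1 r len t by (simp add: e_def)
      next
        case 2
        have "w ! r - w ! (r - 1) \<in> nbrs (w ! r - a)"
          using a(2) 2 by (simp add: nbrs_def znorm_minus_commute)
        moreover have "w ! r - a \<noteq> 0" using a'[of r] r by auto
        ultimately have "\<Delta> * D (w ! r - w ! (r - 1)) \<le> D (w ! r - a)"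
          by (rule D_smooth)
        then show ?thesis
          using 2 r len t by (simp add: e_def)
      next
        case 3
        then show ?thesis using r by (auto simp: e_def nth_list_update)
      qed
    qed
    then show "0 \<le> e r * D (w ! r - w ! (r - 1)) \<and>
        e r * D (w ! r - w ! (r - 1)) \<le> D (w[t := a] ! r - w[t := a] ! (r - 1))"
      using Delta_pos D_nonneg by (simp add: e_def)
  qed
  finally show ?thesis .
qed

text \<open>The contacts that can be lost are those of the old site \<open>w ! t\<close>. They
  involve distinct neighbours of it other than the free site \<open>a\<close>, hence at most
  \<open>2d - 1\<close> of them.\<close>

lemma W_update_ge:
  assumes A: "finite A" "0 \<notin> A" "a \<notin> A"
    and w: "w \<in> rooted n" and t: "1 \<le> t" "t \<le> n" and a: "a \<notin> set w" "a \<in> nbrs (w ! t)"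
  shows "\<Delta>\<^sup>2 * W A n w \<le> (1 + \<kappa>) ^ (2 * CARD('d) - 1) * W A n (w[t := a])"
proof (cases "W A n w = 0")
  case True
  then show ?thesis using W_nonneg[of A n "w[t := a]"] kappa_nonneg by simp
next
  case False
  define P where "P = (!) w ` ({..n} - {t})"
  have nz: "self_int \<kappa> n w \<noteq> 0" "env_int \<kappa> A n w \<noteq> 0" using False by (auto simp: W_def)
  have len: "length w = n + 1" and w0: "w ! 0 = 0" using w by (auto simp: rooted_def)
  have inj: "inj_on ((!) w) ({..n} - {t})"
    using self_int_nonzero_inj[OF nz(1)] by (rule inj_on_subset) auto
  have aP: "a \<notin> P \<union> A" using a(1) A len unfolding P_def by (auto simp: less_Suc_eq_le[symmetric])
  \<comment> \<open>\<open>env_int\<close> says nothing about time 0; there the walk avoids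
    \<open>A\<close> because it starts at the origin and \<open>0 \<notin> A\<close>.\<close>
  have disj: "P \<inter> A = {}"
  proof -
    have "w ! s \<notin> A" if "s \<le> n" for s
      using env_int_nonzero_notin[OF nz(2) A(1), of s] that w0 A(2) by (cases "s = 0") auto
    then show ?thesis by (auto simp: P_def)
  qed
  have "(\<Prod>s\<in>{..n} - {t}. J \<kappa> (w ! s - w ! t)) * (\<Prod>b\<in>A. J \<kappa> (b - w ! t)) =
      (\<Prod>b\<in>P. J \<kappa> (b - w ! t)) * (\<Prod>b\<in>A. J \<kappa> (b - w ! t))"
    unfolding P_def using inj by (simp add: prod.reindex)
  also have "\<dots> = (\<Prod>b\<in>P \<union> A. J \<kappa> (id b - w ! t))"
    using disj A by (subst prod.union_disjoint) (auto simp: P_def)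
  also have "\<dots> \<le> (1 + \<kappa>) ^ (2 * CARD('d) - 1)"
  proof (rule prod_J_le[where N = "nbrs (w ! t) - {a}"])
    show "card (nbrs (w ! t) - {a}) \<le> 2 * CARD('d) - 1"
      using a(2) card_nbrs[of "w ! t"] by simp
  qed (use kappa_nonneg A aP in \<open>auto simp: P_def\<close>)
  finally have crowd: "(\<Prod>s\<in>{..n} - {t}. J \<kappa> (w ! s - w ! t)) * (\<Prod>b\<in>A. J \<kappa> (b - w ! t))
      \<le> (1 + \<kappa>) ^ (2 * CARD('d) - 1)" .
  have "\<Delta>\<^sup>2 * W A n w = (\<Delta>\<^sup>2 * steps D n w) * (self_int \<kappa> n w * env_int \<kappa> A n w)"
    by (simp add: W_def)
  also have "\<dots> \<le> steps D n (w[t := a]) *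
      ((self_int \<kappa> n (w[t := a]) * (\<Prod>s\<in>{..n} - {t}. J \<kappa> (w ! s - w ! t))) *
       (env_int \<kappa> A n (w[t := a]) * (\<Prod>b\<in>A. J \<kappa> (b - w ! t))))"
    using w t a A kappa_nonneg
    by (intro mult_mono steps_update_ge self_int_update_le env_int_update_le steps_nonneg
        mult_nonneg_nonneg self_int_nonneg env_int_nonneg prod_nonneg ballI J_nonneg)
  also have "\<dots> = W A n (w[t := a]) *
      ((\<Prod>s\<in>{..n} - {t}. J \<kappa> (w ! s - w ! t)) * (\<Prod>b\<in>A. J \<kappa> (b - w ! t)))"
    by (simp add: W_def)
  also have "\<dots> \<le> W A n (w[t := a]) * (1 + \<kappa>) ^ (2 * CARD('d) - 1)"
    by (intro mult_left_mono crowd W_nonneg)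
  finally show ?thesis by (simp add: mult.commute)
qed

text \<open>The interaction has a fixed finite number of factors, each at most
  \<open>1 + \<kappa>\<close>, so the step weights dominate.\<close>

lemma W_summable:
  assumes "finite A"
  shows "W A n summable_on rooted n"
proof -
  define C where "C = (1 + \<kappa>) ^ card (pairs n) * ((1 + \<kappa>) ^ card A) ^ n"
  have "self_int \<kappa> n w \<le> (\<Prod>p\<in>pairs n. 1 + \<kappa>)" for w :: "(int ^ 'd) list"
    unfolding self_int_def
    by (intro prod_mono) (auto intro: J_nonneg J_le kappa_nonneg)
  moreover have "env_int \<kappa> A n w \<le> (\<Prod>t = 1..n. \<Prod>a\<in>A. 1 + \<kappa>)" for w
    unfolding env_int_def
    by (intro prod_mono conjI prod_nonneg ballI J_nonneg J_le kappa_nonneg)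
  ultimately have "self_int \<kappa> n w * env_int \<kappa> A n w \<le> C" for w
    unfolding C_def using kappa_nonneg by (intro mult_mono env_int_nonneg) auto
  then have "W A n w \<le> steps D n w * C" for w
    unfolding W_def mult.assoc by (intro mult_left_mono steps_nonneg)
  moreover have "(\<lambda>w. steps D n w * C) summable_on rooted n"
    by (intro summable_on_cmult_left has_sum_imp_summable[OF has_sum_steps[OF D_sum D_nonneg]])
  ultimately show ?thesis
    using W_nonneg summable_on_comparison_test by fastforce
qed

text \<open>The partition function of \<open>n\<close>-step walks in the environment
  \<open>A\<close>; for empty \<open>A\<close> it is the total weight of the theorem.\<close>

definition Z :: "(int ^ 'd) set \<Rightarrow> nat \<Rightarrow> real" where
  "Z A n = (\<Sum>\<^sub>\<infinity>w\<in>rooted n. W A n w)"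

subsection \<open>Removing a site of the environment\<close>

text \<open>A walk of nonzero weight visits each of the at most \<open>2d\<close> neighbours of
  \<open>a\<close> at most once.\<close>

lemma W_insert_le:
  assumes A: "finite A" "a \<notin> A" and w: "w \<in> rooted n" and a: "a \<notin> set w"
  shows "W (insert a A) n w \<le> (1 + \<kappa>) ^ (2 * CARD('d)) * W A n w"
proof (cases "W A n w = 0")
  case True
  then show ?thesis by (auto simp: W_def env_int_insert A)
next
  case False
  then have "self_int \<kappa> n w \<noteq> 0" by (auto simp: W_def)
  then have "inj_on ((!) w) {..n}"
    by (rule self_int_nonzero_inj)
  then have "inj_on ((!) w) {1..n}"
    by (rule inj_on_subset) auto
  then have "(\<Prod>t = 1..n. J \<kappa> (w ! t - a)) \<le> (1 + \<kappa>) ^ (2 * CARD('d))"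
    by (rule prod_J_le[OF kappa_nonneg _ _ _ finite_nbrs card_nbrs, rotated]) auto
  then have "W A n w * (\<Prod>t = 1..n. J \<kappa> (w ! t - a)) \<le> W A n w * (1 + \<kappa>) ^ (2 * CARD('d))"
    by (rule mult_left_mono[OF _ W_nonneg])
  moreover have "W (insert a A) n w = W A n w * (\<Prod>t = 1..n. J \<kappa> (w ! t - a))"
    using A by (simp add: W_def env_int_insert)
  ultimately show ?thesis by (simp only: mult.commute)
qed

text \<open>Rerouting through \<open>a\<close> one visit to a neighbour of \<open>a\<close> maps the walks that can gain weight
  from \<open>a\<close> to walks that \<open>a\<close> kills, at cost \<open>\<Delta>\<^sup>2\<close> for the two modified steps and
  \<open>(1 + \<kappa>) ^ (2d - 1)\<close> for the lost contacts. The visited neighbour recovers the original walk,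
  so the map is at most \<open>2d\<close>-to-one.\<close>
lemma reroute_sum_le:
  fixes n :: nat
  assumes A: "finite A" "0 \<notin> A" "a \<notin> A" and a: "a \<noteq> 0"
  defines "T \<equiv> {w \<in> rooted n. a \<in> set w}"
    and "B \<equiv> {w \<in> rooted n. a \<notin> set w \<and> (\<exists>t\<in>{1..n}. a \<in> nbrs (w ! t))}"
  shows "\<Delta>\<^sup>2 * (\<Sum>\<^sub>\<infinity>w\<in>B. W A n w) \<le>
    (1 + \<kappa>) ^ (2 * CARD('d) - 1) * (2 * real CARD('d) * (\<Sum>\<^sub>\<infinity>w\<in>T. W A n w))"
proof -
  define k where "k = (1 + \<kappa>) ^ (2 * CARD('d) - 1)"
  \<comment> \<open>Any time of a visit to a neighbour of \<open>a\<close> will do; \<open>h\<close>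
    reroutes there and records the neighbour that it replaces.\<close>
  define \<tau> where "\<tau> w = (SOME t. t \<in> {1..n} \<and> a \<in> nbrs (w ! t))" for w
  define h where "h w = (w ! \<tau> w, w[\<tau> w := a])" for w
  have summable: "W A n summable_on S" if "S \<subseteq> rooted n" for S
    using summable_on_subset_banach[OF W_summable[OF A(1)] that] .
  have \<tau>: "\<tau> w \<in> {1..n}" "a \<in> nbrs (w ! \<tau> w)" if "w \<in> B" for w
  proof -
    have "\<exists>t. t \<in> {1..n} \<and> a \<in> nbrs (w ! t)" using that by (auto simp: B_def)
    from someI_ex[OF this] show "\<tau> w \<in> {1..n}" "a \<in> nbrs (w ! \<tau> w)"
      unfolding \<tau>_def by blast+
  qed
  have "inj_on h B"
  proof
    fix v w assume v: "v \<in> B" and w: "w \<in> B" and eq: "h v = h w"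
    have len: "length v = n + 1" "length w = n + 1" using v w by (auto simp: B_def rooted_def)
    have "\<tau> v = \<tau> w"
    proof (rule ccontr)
      \<comment> \<open>If the times differed, the site \<open>a\<close> inserted into
        \<open>v\<close> would already be present in \<open>w\<close>.\<close>
      assume ne: "\<tau> v \<noteq> \<tau> w"
      have "v[\<tau> v := a] ! \<tau> v = a" using \<tau>(1)[OF v] len by simp
      then have "w ! \<tau> v = a" using eq ne by (simp add: h_def)
      then have "a \<in> set w" using \<tau>(1)[OF v] len by (metis Suc_eq_plus1 atLeastAtMost_iff le_imp_less_Suc nth_mem)
      with w show False by (simp add: B_def)
    qed
    then show "v = w"
      using eq by (metis h_def list_update_id list_update_overwrite prod.inject)
  qed
  moreover have h_sub: "h ` B \<subseteq> nbrs a \<times> T"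
  proof safe
    fix y u w assume w: "w \<in> B" and h: "(y, u) = h w"
    have len: "length w = n + 1" "w ! 0 = 0" using w by (auto simp: B_def rooted_def)
    show "y \<in> nbrs a" using \<tau>(2)[OF w] h nbrs_commute by (auto simp: h_def)
    have "a \<in> set (w[\<tau> w := a])"
      using \<tau>(1)[OF w] len by (intro set_update_memI) auto
    then show "u \<in> T" using \<tau>(1)[OF w] len h by (auto simp: T_def h_def rooted_def)
  qed
  ultimately have bij: "bij_betw h B (h ` B)" by (simp add: bij_betw_def)
  have T: "T \<subseteq> rooted n" and B: "B \<subseteq> rooted n" by (auto simp: T_def B_def)
  \<comment> \<open>The factor 1 on the finite set of neighbours makes the sum count each walk of
    \<open>T\<close> once for every possible replaced site.\<close>
  have "((\<lambda>(y, u). 1 * W A n u) has_sum real (card (nbrs a)) * (\<Sum>\<^sub>\<infinity>w\<in>T. W A n w)) (nbrs a \<times> T)"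
    using has_sum_finite[of "nbrs a" "\<lambda>_. 1 :: real"]
    by (intro has_sum_Times_mult has_sum_infsum summable T W_nonneg) simp_all
  then have prod: "((\<lambda>p. W A n (snd p)) has_sum real (card (nbrs a)) * (\<Sum>\<^sub>\<infinity>w\<in>T. W A n w)) (nbrs a \<times> T)"
    by (simp add: case_prod_unfold)
  have summ_h: "(\<lambda>p. W A n (snd p)) summable_on h ` B"
    using summable_on_subset_banach[OF has_sum_imp_summable[OF prod] h_sub] .
  then have summ_B: "(\<lambda>w. W A n (snd (h w))) summable_on B"
    using summable_on_reindex_bij_betw[OF bij, of "\<lambda>p. W A n (snd p)"] by simp
  have "\<Delta>\<^sup>2 * (\<Sum>\<^sub>\<infinity>w\<in>B. W A n w) = (\<Sum>\<^sub>\<infinity>w\<in>B. \<Delta>\<^sup>2 * W A n w)"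
    by (rule infsum_cmult_right'[symmetric])
  also have "\<dots> \<le> (\<Sum>\<^sub>\<infinity>w\<in>B. k * W A n (snd (h w)))"
  proof (rule infsum_mono)
    fix w assume w: "w \<in> B"
    show "\<Delta>\<^sup>2 * W A n w \<le> k * W A n (snd (h w))"
      using W_update_ge[OF A, of w n "\<tau> w"] \<tau>[OF w] w by (auto simp: h_def k_def B_def)
  qed (intro summable_on_cmult_right summable B summ_B)+
  also have "\<dots> = k * (\<Sum>\<^sub>\<infinity>w\<in>B. W A n (snd (h w)))"
    by (rule infsum_cmult_right')
  also have "(\<Sum>\<^sub>\<infinity>w\<in>B. W A n (snd (h w))) = (\<Sum>\<^sub>\<infinity>p\<in>h ` B. W A n (snd p))"
    by (rule infsum_reindex_bij_betw[OF bij])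
  also have "\<dots> \<le> (\<Sum>\<^sub>\<infinity>p\<in>nbrs a \<times> T. W A n (snd p))"
    by (rule infsum_mono2[OF summ_h has_sum_imp_summable[OF prod] h_sub W_nonneg])
  also have "\<dots> = real (card (nbrs a)) * (\<Sum>\<^sub>\<infinity>w\<in>T. W A n w)"
    using prod by (rule infsumI)
  also have "\<dots> \<le> 2 * real CARD('d) * (\<Sum>\<^sub>\<infinity>w\<in>T. W A n w)"
    using of_nat_mono[OF card_nbrs[of a], where ?'a = real]
    by (intro mult_right_mono infsum_nonneg W_nonneg) simp
  finally show ?thesis using kappa_nonneg by (simp add: k_def mult_left_mono)
qed

text \<open>Inserting \<open>a\<close> kills the walks in \<open>T\<close>, multiplies the weight of
  those in \<open>B\<close> by at most \<open>q\<close>, and leaves those in \<open>R\<close>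
  unchanged. What remains is \<open>(q - 1) * S A B \<le> S A T\<close>, the point where
  \<open>kappa_small\<close> meets the rerouting bound.\<close>

lemma Z_insert_le:
  assumes A: "finite A" "0 \<notin> A" "a \<notin> A" and a: "a \<noteq> 0"
  shows "Z (insert a A) n \<le> Z A n"
proof -
  define T where "T = {w \<in> rooted n. a \<in> set w}"
  define B where "B = {w \<in> rooted n. a \<notin> set w \<and> (\<exists>t\<in>{1..n}. a \<in> nbrs (w ! t))}"
  define R where "R = {w \<in> rooted n. a \<notin> set w \<and> \<not> (\<exists>t\<in>{1..n}. a \<in> nbrs (w ! t))}"
  define q where "q = (1 + \<kappa>) ^ (2 * CARD('d))"
  define k where "k = (1 + \<kappa>) ^ (2 * CARD('d) - 1)"
  define S where "S C X = (\<Sum>\<^sub>\<infinity>w\<in>X. W C n w)" for C X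
  have sub: "T \<subseteq> rooted n" "B \<subseteq> rooted n" "R \<subseteq> rooted n"
    and un: "rooted n = T \<union> (B \<union> R)" and disj: "T \<inter> (B \<union> R) = {}" "B \<inter> R = {}"
    by (auto simp: T_def B_def R_def)
  have summable: "W C n summable_on X" if "finite C" "X \<subseteq> rooted n" for C X
    using summable_on_subset_banach[OF W_summable that(2)] that(1) by blast
  have Z: "Z C n = S C T + (S C B + S C R)" if "finite C" for C
    unfolding Z_def S_def un using sub disj that
    by (subst infsum_Un_disjoint; (subst infsum_Un_disjoint)?) (auto intro!: summable)
  have nth_a: "w ! t = a \<Longrightarrow> t \<in> {1..n} \<Longrightarrow> w \<in> rooted n \<Longrightarrow> a \<in> set w" for w t
    by (auto simp: rooted_def)
  have "S (insert a A) T = 0"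
    unfolding S_def
  proof (rule infsum_0)
    fix w assume w: "w \<in> T"
    then obtain t where t: "t < length w" "w ! t = a" by (auto simp: T_def in_set_conv_nth)
    \<comment> \<open>A visit at time 0 would escape \<open>env_int\<close>; it is excluded by
      \<open>a \<noteq> 0\<close>.\<close>
    then have "t \<in> {1..n}" using w a by (cases "t = 0") (auto simp: T_def rooted_def)
    then have "(\<Prod>t = 1..n. J \<kappa> (w ! t - a)) = 0"
      using t by (intro prod_zero) (auto simp: J_diff)
    then show "W (insert a A) n w = 0"
      using A by (simp add: W_def env_int_insert)
  qed
  moreover have "S (insert a A) B \<le> q * S A B"
    unfolding S_def q_def infsum_cmult_right'[symmetric]
    using A by (intro infsum_mono summable_on_cmult_right summable sub W_insert_le)
      (auto simp: B_def)
  moreover have "S (insert a A) R = S A R"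
    unfolding S_def
  proof (rule infsum_cong)
    fix w assume w: "w \<in> R"
    have "(\<Prod>t = 1..n. J \<kappa> (w ! t - a)) = (\<Prod>t = 1..n. 1)"
      using w nth_a[of w] nbrs_commute[of a] by (intro prod.cong) (auto simp: J_diff R_def)
    then show "W (insert a A) n w = W A n w"
      using A by (simp add: W_def env_int_insert)
  qed
  moreover have "(q - 1) * S A B \<le> S A T"
  proof -
    have k: "0 < k" using kappa_nonneg by (simp add: k_def)
    have S_nonneg: "0 \<le> S A B" unfolding S_def by (intro infsum_nonneg W_nonneg)
    have "q - 1 \<le> \<Delta>\<^sup>2 / (2 * real CARD('d) * k)"
      using kappa_small by (simp add: q_def k_def)
    then have "(q - 1) * S A B \<le> \<Delta>\<^sup>2 / (2 * real CARD('d) * k) * S A B"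
      using S_nonneg by (rule mult_right_mono)
    also have "\<dots> = \<Delta>\<^sup>2 * S A B / (2 * real CARD('d) * k)" by simp
    also have "\<dots> \<le> k * (2 * real CARD('d) * S A T) / (2 * real CARD('d) * k)"
      using reroute_sum_le[OF A a, of n] k
      by (intro divide_right_mono) (simp_all add: S_def T_def B_def k_def)
    also have "\<dots> = S A T" using k by simp
    finally show ?thesis .
  qed
  ultimately have "S (insert a A) T + (S (insert a A) B + S (insert a A) R) \<le> S A T + (S A B + S A R)"
    by (simp add: algebra_simps)
  then show ?thesis using A by (simp add: Z)
qed

lemma Z_le_Z_empty:
  assumes "finite A" "0 \<notin> A"
  shows "Z A n \<le> Z {} n"
  using assms
proof (induction A rule: finite_induct)
  case (insert a A)
  then show ?case using Z_insert_le[of A a n] by auto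
qed simp

text \<open>For a fixed first piece \<open>u\<close>, summing over the second piece gives
  \<open>Z (past u) n\<close>, and deleting the whole past only increases this.\<close>

lemma Z_empty_add_le: "Z {} (m + n) \<le> Z {} m * Z {} n"
proof -
  define past where "past u = (\<lambda>s. u ! s - u ! m) ` {..<m}" for u :: "(int ^ 'd) list"
  define f where "f = (\<lambda>(u, v). W {} m u * W (past u) n v)"
  have fin: "finite (past u)" for u by (simp add: past_def)
  have f: "W {} (m + n) (glue u v) = f (u, v)" if "u \<in> rooted m" "v \<in> rooted n" for u v
    using that by (simp add: f_def W_def past_def steps_glue self_int_glue env_int_def)
  have summ: "f summable_on rooted m \<times> rooted n"
  proof -
    have "(\<lambda>p. W {} (m + n) (case p of (u, v) \<Rightarrow> glue u v)) summable_on rooted m \<times> rooted n"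
      using W_summable[of "{}" "m + n"] by (subst summable_on_reindex_bij_betw[OF bij_betw_glue]) simp
    then show ?thesis by (rule summable_on_cong[THEN iffD1, rotated]) (auto simp: f)
  qed
  have "Z {} (m + n) = (\<Sum>\<^sub>\<infinity>p\<in>rooted m \<times> rooted n. W {} (m + n) (case p of (u, v) \<Rightarrow> glue u v))"
    unfolding Z_def by (rule infsum_reindex_bij_betw[OF bij_betw_glue, symmetric])
  also have "\<dots> = infsum f (rooted m \<times> rooted n)"
    by (rule infsum_cong) (auto simp: f)
  also have "\<dots> = (\<Sum>\<^sub>\<infinity>u\<in>rooted m. \<Sum>\<^sub>\<infinity>v\<in>rooted n. f (u, v))"
    using infsum_Sigma_banach[OF summ] by simp
  also have "\<dots> = (\<Sum>\<^sub>\<infinity>u\<in>rooted m. W {} m u * Z (past u) n)"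
    by (simp add: f_def Z_def infsum_cmult_right')
  also have "\<dots> \<le> (\<Sum>\<^sub>\<infinity>u\<in>rooted m. W {} m u * Z {} n)"
  proof -
    have le: "W {} m u * Z (past u) n \<le> W {} m u * Z {} n" for u
    proof (cases "W {} m u = 0")
      \<comment> \<open>A first piece of nonzero weight never visits its end point before time
        \<open>m\<close>; after translation this says \<open>0 \<notin> past u\<close>.\<close>
      case False
      then have "self_int \<kappa> m u \<noteq> 0" by (auto simp: W_def)
      then have "inj_on ((!) u) {..m}" by (rule self_int_nonzero_inj)
      then have "0 \<notin> past u" unfolding past_def inj_on_def
        by (metis (no_types, lifting) atMost_iff dual_order.refl eq_iff_diff_eq_0 imageE lessThan_iff less_imp_le less_irrefl)
      then show ?thesis by (intro mult_left_mono Z_le_Z_empty fin W_nonneg)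
    qed simp
    have bound: "(\<lambda>u. W {} m u * Z {} n) summable_on rooted m"
      by (intro summable_on_cmult_left W_summable) simp
    have Z_nonneg: "0 \<le> Z A n" for A unfolding Z_def by (intro infsum_nonneg W_nonneg)
    have "(\<lambda>u. W {} m u * Z (past u) n) summable_on rooted m"
      by (rule summable_on_comparison_test[OF bound le]) (intro mult_nonneg_nonneg W_nonneg Z_nonneg)
    then show ?thesis by (intro infsum_mono bound le)
  qed
  also have "\<dots> = Z {} m * Z {} n"
    by (simp add: Z_def infsum_cmult_left')
  finally show ?thesis .
qed

subsection \<open>Lower bound and convergence\<close>

text \<open>The sets \<open>walks n x\<close> partition the rooted walks by their end point.\<close>

lemma total_weight_eq_Z: "total_weight D \<kappa> n = Z {} n"
proof -
  define f where "f p = W {} n (snd p)" for p :: "(int ^ 'd) \<times> (int ^ 'd) list"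
  have bij: "bij_betw snd (Sigma UNIV (walks n)) (rooted n :: (int ^ 'd) list set)"
    by (rule bij_betwI[where g = "\<lambda>w. (w ! n, w)"]) (auto simp: walks_def rooted_def)
  have "W {} n summable_on rooted n"
    by (rule W_summable) simp
  then have summ: "f summable_on Sigma UNIV (walks n)"
    unfolding f_def by (subst summable_on_reindex_bij_betw[OF bij])
  have "Z {} n = infsum f (Sigma UNIV (walks n))"
    unfolding Z_def f_def by (rule infsum_reindex_bij_betw[OF bij, symmetric])
  also have "\<dots> = (\<Sum>\<^sub>\<infinity>x\<in>UNIV. \<Sum>\<^sub>\<infinity>w\<in>walks n x. f (x, w))"
    using infsum_Sigma_banach[OF summ] by simp
  also have "\<dots> = total_weight D \<kappa> n"
    by (simp add: total_weight_def connectivity_def f_def W_empty)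
  finally show ?thesis ..
qed

text \<open>Reflecting coordinate \<open>j\<close> sends the part with \<open>x $ j < 0\<close> into
  the part with \<open>x $ j \<ge> 0\<close>, so each new constraint keeps at least half of the
  mass.\<close>

lemma nonneg_coords_mass:
  assumes "finite I"
  shows "(1 / 2) ^ card I \<le> (\<Sum>\<^sub>\<infinity>x\<in>{x. \<forall>i\<in>I. 0 \<le> x $ i}. D x)"
  using assms
proof (induction I rule: finite_induct)
  case empty
  then show ?case using infsumI[OF D_sum] by simp
next
  case (insert j I)
  define H where "H = {x :: int ^ 'd. \<forall>i\<in>I. 0 \<le> x $ i}"
  define P where "P = {x :: int ^ 'd. \<forall>i\<in>insert j I. 0 \<le> x $ i}"
  define N where "N = {x \<in> H. x $ j < 0}"
  define flip :: "int ^ 'd \<Rightarrow> int ^ 'd" where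
    "flip x = (\<chi> i. if i = j then - (x $ i) else x $ i)" for x
  have summ: "D summable_on X" for X
    using summable_on_subset_banach[OF has_sum_imp_summable[OF D_sum]] by blast
  have flip2: "flip (flip x) = x" for x by (simp add: flip_def vec_eq_iff)
  have "(\<Sum>\<^sub>\<infinity>x\<in>N. D x) \<le> (\<Sum>\<^sub>\<infinity>x\<in>P. D x)"
  proof -
    have "(\<Sum>\<^sub>\<infinity>x\<in>N. D x) = (\<Sum>\<^sub>\<infinity>x\<in>N. D (flip x))"
      by (simp add: flip_def D_flip)
    also have "\<dots> = (\<Sum>\<^sub>\<infinity>x\<in>flip ` N. D x)"
      using infsum_reindex[of flip N D] flip2 by (metis comp_apply infsum_cong inj_on_inverseI)
    also have "\<dots> \<le> (\<Sum>\<^sub>\<infinity>x\<in>P. D x)"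
      using insert.hyps by (intro infsum_mono2 summ D_nonneg) (auto simp: N_def H_def P_def flip_def)
    finally show ?thesis .
  qed
  moreover have "(\<Sum>\<^sub>\<infinity>x\<in>H. D x) = (\<Sum>\<^sub>\<infinity>x\<in>P. D x) + (\<Sum>\<^sub>\<infinity>x\<in>N. D x)"
  proof -
    have "H = P \<union> N" by (auto simp: H_def P_def N_def)
    then show ?thesis
      by (metis (no_types, lifting) infsum_Un_disjoint[OF summ summ, of P N] N_def P_def disjoint_iff insertCI mem_Collect_eq not_le)
  qed
  ultimately have "(\<Sum>\<^sub>\<infinity>x\<in>H. D x) \<le> 2 * (\<Sum>\<^sub>\<infinity>x\<in>P. D x)" by simp
  then show ?case using insert by (simp add: H_def P_def)
qed

lemma Z_ge_power: "((1 / 2) ^ CARD('d)) ^ n \<le> Z {} n"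
proof -
  define O' where "O' = {x :: int ^ 'd. \<forall>i\<in>UNIV. 0 \<le> x $ i}"
  \<comment> \<open>With \<open>D\<close> cut off outside the orthant, the rooted walks have total
    step weight equal to the \<open>n\<close>-th power of the orthant's mass.\<close>
  define g where "g x = (if x \<in> O' then D x else 0)" for x
  have "(D has_sum infsum D O') O'"
    using summable_on_subset_banach[OF has_sum_imp_summable[OF D_sum]] by (intro has_sum_infsum) blast
  then have "(g has_sum infsum D O') UNIV"
    by (rule has_sum_cong_neutral[THEN iffD1, rotated -1]) (auto simp: g_def)
  moreover have g_nonneg: "0 \<le> g x" for x by (simp add: g_def D_nonneg)
  ultimately have sum_g: "(steps g n has_sum infsum D O' ^ n) (rooted n)"
    by (rule has_sum_steps)
  have le: "steps g n w \<le> W {} n w" if "w \<in> rooted n" for w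
  proof (cases "steps g n w = 0")
    case False
    \<comment> \<open>Zero steps are excluded by \<open>D 0 = 0\<close>, which makes the increase of
      the coordinate sum strict.\<close>
    have step: "w ! r - w ! (r - 1) \<in> O' - {0}" if "r \<in> {1..n}" for r
    proof -
      have "g (w ! r - w ! (r - 1)) \<noteq> 0" using False that unfolding steps_def by fastforce
      then show ?thesis by (auto simp: g_def D_0 split: if_splits)
    qed
    \<comment> \<open>A linear functional positive on all allowed steps: it separates the sites of
      the walk, so every factor of \<open>self_int\<close> is at least 1.\<close>
    define \<sigma> :: "int ^ 'd \<Rightarrow> int" where "\<sigma> x = (\<Sum>i\<in>UNIV. x $ i)" for x
    have \<sigma>_pos: "0 < \<sigma> x" if "x \<in> O' - {0}" for x
    proof -
      obtain i where i: "x $ i \<noteq> 0" using \<open>x \<in> O' - {0}\<close> by (auto simp: vec_eq_iff)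
      show ?thesis unfolding \<sigma>_def
        using that i by (intro sum_pos2[of _ i]) (auto simp: O'_def order_less_le)
    qed
    have incr: "\<sigma> (w ! s) < \<sigma> (w ! t)" if "s < t" "t \<le> n" for s t
      using that
    proof (induction t)
      case (Suc t)
      have "0 < \<sigma> (w ! Suc t - w ! t)" using \<sigma>_pos[OF step[of "Suc t"]] Suc.prems by simp
      then have "\<sigma> (w ! t) < \<sigma> (w ! Suc t)" by (simp add: \<sigma>_def sum_subtractf)
      then show ?case using Suc by (cases "s = t") force+
    qed simp
    have "1 \<le> self_int \<kappa> n w"
      unfolding self_int_def
    proof (intro prod_ge_1)
      fix p assume "p \<in> pairs n"
      then obtain s t where "p = (s, t)" "s < t" "t \<le> n" by (auto simp: pairs_def)
      then show "1 \<le> (case p of (s, t) \<Rightarrow> J \<kappa> (w ! s - w ! t))"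
        using incr[of s t] J_ge_1[OF kappa_nonneg, of "w ! s" "w ! t"] by fastforce
    qed
    moreover have "steps g n w = steps D n w"
      unfolding steps_def using step by (intro prod.cong) (auto simp: g_def)
    ultimately show ?thesis
      using mult_left_mono[of 1 "self_int \<kappa> n w" "steps D n w"] steps_nonneg[of n w]
      by (simp add: W_def env_int_def)
  qed (simp add: W_nonneg)
  have "((1 / 2) ^ CARD('d)) ^ n \<le> infsum D O' ^ n"
    using nonneg_coords_mass[of UNIV] by (intro power_mono) (auto simp: O'_def)
  also have "\<dots> \<le> Z {} n"
    unfolding Z_def by (rule has_sum_mono[OF sum_g has_sum_infsum[OF W_summable] le]) auto
  finally show ?thesis .
qed

lemma root_total_weight_convergent:
  "\<exists>\<mu>. (\<lambda>n. root n (total_weight D \<kappa> n)) \<longlonglongrightarrow> \<mu> \<and>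
    (1 / 2) ^ CARD('d) \<le> \<mu> \<and> \<mu> \<le> total_weight D \<kappa> 1"
  unfolding total_weight_eq_Z
proof (rule submultiplicative_root_convergent)
  show "((1 / 2) ^ CARD('d)) ^ n \<le> Z {} n" for n by (rule Z_ge_power)
  have "0 < ((1 / 2 :: real) ^ CARD('d)) ^ n" for n by simp
  then show "0 < Z {} n" for n using Z_ge_power less_le_trans by blast
qed (simp_all add: Z_empty_add_le)

end

section \<open>From jump weights to the assumptions of the locale\<close>

lemma jump_weight_smooth:
  fixes D :: "int ^ 'd::finite \<Rightarrow> real"
  assumes D: "jump_weight D" and \<Delta>: "smoothness D = ereal \<Delta>"
    and xy: "x \<in> nbrs y" and x: "x \<noteq> 0" and y: "y \<noteq> 0"
  shows "0 < D x" "\<Delta> * D x \<le> D y"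
proof -
  have "smoothness D \<le> (case (x, y) of (x, y) \<Rightarrow> if x = 0 then \<infinity> else ereal (D y / D x))"
    unfolding smoothness_def using xy y by (intro INF_lower) (auto simp: nbrs_def)
  then have le: "\<Delta> \<le> D y / D x" using x \<Delta> by simp
  moreover have "0 < \<Delta>" "0 \<le> D x" using D \<Delta> by (auto simp: jump_weight_def)
  \<comment> \<open>If \<open>D x\<close> were 0, division by zero would give the ratio 0,
    contradicting \<open>0 < \<Delta> \<le> D y / D x\<close>.\<close>
  ultimately show pos: "0 < D x" by (cases "D x = 0") auto
  show "\<Delta> * D x \<le> D y" using le pos by (simp add: field_simps)
qed

text \<open>The ratios for two adjacent nonzero sites, taken in both directions, are inverse to each
  other, so they cannot both exceed 1. The sites are 1 and 2 units along an arbitrary axis, for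
  which \<open>undefined\<close> stands.\<close>

lemma smoothness_le_1:
  fixes D :: "int ^ 'd::finite \<Rightarrow> real"
  assumes D: "jump_weight D" and \<Delta>: "smoothness D = ereal \<Delta>"
  shows "\<Delta> \<le> 1"
proof (rule ccontr)
  assume gt: "\<not> \<Delta> \<le> 1"
  define e :: "int \<Rightarrow> int ^ 'd" where "e s = axis undefined s" for s
  have "e 2 - e 1 = axis undefined 1" "e 1 - e 2 = axis undefined (-1)"
    by (auto simp: e_def vec_eq_iff axis_def)
  then have nb: "e 1 \<in> nbrs (e 2)" "e 2 \<in> nbrs (e 1)" by (auto simp: nbrs_def)
  have nz: "e 1 \<noteq> 0" "e 2 \<noteq> 0" by (auto simp: e_def axis_eq_0_iff)
  note 1 = jump_weight_smooth[OF D \<Delta> nb(1) nz] and 2 = jump_weight_smooth[OF D \<Delta> nb(2) nz(2,1)]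
  have "D (e 1) < \<Delta> * D (e 1)" "D (e 2) < \<Delta> * D (e 2)" using gt 1(1) 2(1) by simp_all
  with 1(2) 2(2) show False by linarith
qed

theorem theorem1:
  fixes D :: "int ^ 'd::finite \<Rightarrow> real" and \<kappa> \<Delta> :: real
  assumes "jump_weight D"
    and "smoothness D = ereal \<Delta>"
    and "\<kappa> > 0"
    and "(1 + \<kappa>) ^ (2 * CARD('d)) \<le>
           1 + \<Delta>\<^sup>2 / (2 * real CARD('d) * (1 + \<kappa>) ^ (2 * CARD('d) - 1))"
  shows "\<exists>\<mu>::real. (\<lambda>n. root n (total_weight D \<kappa> n)) \<longlonglongrightarrow> \<mu> \<and>
           (1 / 2) ^ CARD('d) \<le> \<mu> \<and> \<mu> \<le> total_weight D \<kappa> 1"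
proof -
  interpret attractive_walk D \<kappa> \<Delta>
  proof
    show "\<Delta> * D x \<le> D y" if "x \<in> nbrs y" "y \<noteq> 0" for x y
    proof (cases "x = 0")
      case False
      then show ?thesis using jump_weight_smooth[OF assms(1,2) that(1)] that(2) by blast
    \<comment> \<open>For \<open>x = 0\<close> the infinite ratio of \<open>smoothness\<close> gives
      no bound, but \<open>D 0 = 0\<close> makes the left side vanish.\<close>
    qed (use assms in \<open>simp add: jump_weight_def\<close>)
  qed (use assms smoothness_le_1[OF assms(1,2)] in \<open>auto simp: jump_weight_def\<close>)
  show ?thesis by (rule root_total_weight_convergent)
qed

end
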